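(* Let $X_1,\dots,X_n$ be independent random variables supported on $\mathbb{Z}_{\ge0}\times\mathbb{Z}_{\ge0}$. Then the probability matrix of their sum is $$A(X_1+\cdots+X_n)=A(X_1)\diamond\cdots\diamond A(X_n),$$ and hence, if $A(X_1),\dots,A(X_n)$ are positive semidefinite, then $A(X_1+\cdots+X_n)$ is also positive semidefinite.
   Context: For a random variable $X$ supported on $\mathbb{Z}_{\ge0}\times\mathbb{Z}_{\ge0}$, its probability matrix $A(X)$ is the semi-infinite matrix indexed by $(i,j)\in\mathbb{Z}_{\ge0}\times\mathbb{Z}_{\ge0}$ with $A(X)_{ij}:=\mathrm{Prob}(X=(i,j))$. The convolution (Jury product) of semi-infinite matrices is $(A\diamond B)_{ij}:=\sum_{\ell=0}^i\sum_{\kappa=0}^j a_{\ell,\kappa}b_{i-\ell,j-\kappa}$ for all $i,j\ge0$ (an associative and commutative operation). A semi-infinite matrix is positive semidefinite if all its leading principal submatrices are positive semidefinite, where a finite matrix $A\in\mathbb{C}^{N\times N}$ is positive semidefinite if $A^*=A$ and $z^*Az\ge0$ for all $z\in\mathbb{C}^N$. *)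

theory Defs
  imports "HOL-Probability.Probability" "Jordan_Normal_Form.Schur_Decomposition"
begin

text \<open>Semi-infinite complex matrices, indexed from 0.\<close>

type_synonym semi_inf_mat = "nat \<Rightarrow> nat \<Rightarrow> complex"

text \<open>The entries are real; they are embedded into the complex numbers because
  positive semidefiniteness is a notion for complex matrices.\<close>

definition prob_matrix :: "'w measure \<Rightarrow> ('w \<Rightarrow> nat \<times> nat) \<Rightarrow> semi_inf_mat" where
  "prob_matrix M X i j = complex_of_real (measure M {\<omega> \<in> space M. X \<omega> = (i, j)})"

definition jury_prod :: "semi_inf_mat \<Rightarrow> semi_inf_mat \<Rightarrow> semi_inf_mat" (infixl "\<diamondop>" 70) where
  "(A \<diamondop> B) i j = (\<Sum>l = 0..i. \<Sum>k = 0..j. A l k * B (i - l) (j - k))"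

definition leading_submat :: "nat \<Rightarrow> semi_inf_mat \<Rightarrow> complex mat" where
  "leading_submat N A = mat N N (\<lambda>(i, j). A i j)"

text \<open>The order is the one on the complex numbers from \<^theory>\<open>HOL-Library.Complex_Order\<close>:
  \<^prop>\<open>0 \<le> (c :: complex)\<close> says that \<^term>\<open>c\<close> is real and nonnegative.\<close>

definition psd_mat :: "complex mat \<Rightarrow> bool" where
  "psd_mat A \<longleftrightarrow> square_mat A \<and> mat_adjoint A = A \<and>
     (\<forall>z \<in> carrier_vec (dim_row A). 0 \<le> scalar_prod (conjugate z) (A *\<^sub>v z))"

definition psd_semi_inf :: "semi_inf_mat \<Rightarrow> bool" where
  "psd_semi_inf A \<longleftrightarrow> (\<forall>N. psd_mat (leading_submat N A))"

end

theory Submission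
  imports Defs
begin

text \<open>For the semidefiniteness of a Jury product, write the quadratic form of
  \<open>A \<diamondop> B\<close> at \<open>z\<close> as the form of the Kronecker product of \<open>A\<close> and \<open>B\<close> at the tensor
  \<open>(l, p) \<mapsto> z (l + p)\<close>, cut off at \<open>l + p < N\<close>. A Gram decomposition of \<open>A\<close> turns this into
  a sum of values of the form of \<open>B\<close>.\<close>

section \<open>Positive semidefinite kernels\<close>

text \<open>Index sets are arbitrary rather than initial segments of the naturals, so that an
  induction can eliminate one index at a time. Vectors are total functions of which only the values
  on \<open>S\<close> count.\<close>

definition kernel_form :: "'a set \<Rightarrow> ('a \<Rightarrow> 'a \<Rightarrow> complex) \<Rightarrow> ('a \<Rightarrow> complex) \<Rightarrow> complex" where
  "kernel_form S A z = (\<Sum>i\<in>S. \<Sum>j\<in>S. cnj (z i) * A i j * z j)"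

definition psd_kernel :: "'a set \<Rightarrow> ('a \<Rightarrow> 'a \<Rightarrow> complex) \<Rightarrow> bool" where
  "psd_kernel S A \<longleftrightarrow> (\<forall>i\<in>S. \<forall>j\<in>S. A j i = cnj (A i j)) \<and> (\<forall>z. 0 \<le> kernel_form S A z)"

lemma kernel_form_cong:
  assumes "\<And>i. i \<in> S \<Longrightarrow> z i = w i"
  shows "kernel_form S A z = kernel_form S A w"
  unfolding kernel_form_def using assms by (intro sum.cong) auto

lemma kernel_form_indicator:
  assumes "finite S" "y \<in> S"
  shows "kernel_form S A (\<lambda>i. if i = y then 1 else 0) = A y y"
proof -
  have "kernel_form S A (\<lambda>i. if i = y then 1 else 0)
      = (\<Sum>i\<in>S. if i = y then (\<Sum>j\<in>S. if j = y then A i j else 0) else 0)"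
    unfolding kernel_form_def by (intro sum.cong) (auto intro!: sum.cong)
  then show ?thesis
    using assms by simp
qed

text \<open>Isolates the coordinate \<open>c\<close> at \<open>x\<close>, which can then be chosen
  to suit: a multiple of an entry \<open>A x y\<close>, zero, or the minimiser of the form.\<close>

lemma kernel_form_insert:
  assumes "finite S" "x \<notin> S" and herm: "\<And>i. i \<in> S \<Longrightarrow> A i x = cnj (A x i)"
  defines "s \<equiv> \<lambda>z. \<Sum>j\<in>S. A x j * z j"
  shows "kernel_form (insert x S) A (z(x := c))
    = cnj c * A x x * c + cnj c * s z + cnj (s z) * c + kernel_form S A z"
proof -
  let ?w = "z(x := c)"
  have w: "?w i = z i" if "i \<in> S" for i
    using that assms(2) by auto
  have "kernel_form (insert x S) A ?w = cnj c * A x x * c + (\<Sum>j\<in>S. cnj c * A x j * ?w j)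
      + ((\<Sum>i\<in>S. cnj (?w i) * A i x * c) + kernel_form S A ?w)"
    unfolding kernel_form_def using assms(1,2) by (simp add: sum.distrib)
  also have "(\<Sum>j\<in>S. cnj c * A x j * ?w j) = cnj c * s z"
    unfolding s_def sum_distrib_left using w by (intro sum.cong) auto
  also have "(\<Sum>i\<in>S. cnj (?w i) * A i x * c) = cnj (s z) * c"
    unfolding s_def sum_distrib_right cnj_sum using w herm by (intro sum.cong) auto
  also have "kernel_form S A ?w = kernel_form S A z"
    using w by (rule kernel_form_cong)
  finally show ?thesis
    by (simp only: algebra_simps)
qed

lemma psd_kernel_diag:
  assumes "psd_kernel S A" "finite S" "x \<in> S"
  shows "0 \<le> A x x"
  using assms kernel_form_indicator[of S x A] unfolding psd_kernel_def by metis

text \<open>With \<open>A x x = 0\<close> the form at \<open>c\<close> times the unit vector of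
  \<open>x\<close> plus that of \<open>y\<close> is real-affine in \<open>c\<close>. Such a function
  is bounded below only if its linear part, given by \<open>A x y\<close>, vanishes.\<close>

lemma psd_kernel_zero_diag:
  assumes psd: "psd_kernel S A" and "finite S" "x \<in> S" "y \<in> S" "A x x = 0"
  shows "A x y = 0"
proof (rule ccontr)
  assume nz: "A x y \<noteq> 0"
  then have "x \<noteq> y"
    using assms by auto
  let ?T = "S - {x}" and ?z = "\<lambda>i. if i = y then 1 else 0 :: complex"
  have S: "insert x ?T = S" "finite ?T" "x \<notin> ?T" "y \<in> ?T"
    using assms \<open>x \<noteq> y\<close> by auto
  have herm: "A i x = cnj (A x i)" if "i \<in> ?T" for i
    using psd that assms(3) unfolding psd_kernel_def by blast
  \<comment> \<open>On \<open>c = - t * A x y\<close> the form is \<open>A y y\<close> minus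
    \<open>2 * t\<close> times the squared modulus of \<open>A x y\<close>; this \<open>t\<close>
    brings its real part to -1.\<close>
  define t where "t = (Re (A y y) + 1) / (2 * (cmod (A x y))\<^sup>2)"
  define c where "c = - complex_of_real t * A x y"
  have s: "(\<Sum>j\<in>?T. A x j * ?z j) = A x y"
    using S by (simp add: if_distrib cong: if_cong)
  have "0 \<le> kernel_form S A (?z(x := c))"
    using psd unfolding psd_kernel_def by blast
  also have "kernel_form S A (?z(x := c)) = cnj c * A x y + cnj (A x y) * c + A y y"
    using kernel_form_insert[of ?T x A ?z c, OF S(2,3) herm] S kernel_form_indicator[OF S(2,4), of A]
      assms s by simp
  also have "cnj c * A x y = - of_real (t * (cmod (A x y))\<^sup>2)"
    unfolding c_def by (simp add: complex_norm_square mult.commute del: of_real_power)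
  also have "cnj (A x y) * c = - of_real (t * (cmod (A x y))\<^sup>2)"
    unfolding c_def by (simp add: complex_norm_square mult.commute mult.left_commute del: of_real_power)
  finally have "0 \<le> Re (A y y) - 2 * (t * (cmod (A x y))\<^sup>2)"
    by (simp add: less_eq_complex_def)
  moreover have "2 * (t * (cmod (A x y))\<^sup>2) = Re (A y y) + 1"
    using nz unfolding t_def by simp
  ultimately show False
    by linarith
qed

text \<open>Each value of the complement's form at \<open>z\<close> is a value of the form of
  \<open>A\<close> at a suitable extension of \<open>z\<close> to \<open>x\<close>.\<close>

lemma psd_kernel_schur_complement:
  assumes psd: "psd_kernel (insert x S) A" and "finite S" "x \<notin> S"
  shows "psd_kernel S (\<lambda>i j. A i j - A i x * A x j / A x x)"
proof -
  have herm: "A j i = cnj (A i j)" if "i \<in> insert x S" "j \<in> insert x S" for i j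
    using psd that unfolding psd_kernel_def by blast
  show ?thesis
  proof (cases "A x x = 0")
    case True
    have "0 \<le> kernel_form S A z" for z
    proof -
      have "0 \<le> kernel_form (insert x S) A (z(x := 0))"
        using psd unfolding psd_kernel_def by blast
      also have "kernel_form (insert x S) A (z(x := 0)) = kernel_form S A z"
        using kernel_form_insert[of S x A z 0, OF assms(2,3) herm] by simp
      finally show ?thesis .
    qed
    then have "psd_kernel S A"
      using herm unfolding psd_kernel_def by blast
    \<comment> \<open>Division by 0 gives 0, so with a zero pivot the subtracted term disappears and
      the complement is \<open>A\<close> itself.\<close>
    then show ?thesis
      using True by simp
  next
    case False
    let ?A = "\<lambda>i j. A i j - A i x * A x j / A x x"
    have real: "cnj (A x x) = A x x"
      using herm[of x x] by simp
    have "0 \<le> kernel_form S ?A z" for z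
    proof -
      define s where "s = (\<Sum>j\<in>S. A x j * z j)"
      \<comment> \<open>The minimiser, found by completing the square: the terms with
        \<open>c\<close> add up to \<open>- cnj s * s / A x x\<close>, which is the correction made
        by the complement.\<close>
      define c where "c = - s / A x x"
      have cs: "cnj s = (\<Sum>i\<in>S. cnj (z i) * A i x)"
        unfolding s_def cnj_sum using herm[of x] by (intro sum.cong) auto
      have "0 \<le> kernel_form (insert x S) A (z(x := c))"
        using psd unfolding psd_kernel_def by blast
      also have "\<dots> = cnj c * A x x * c + cnj c * s + cnj s * c + kernel_form S A z"
        unfolding s_def using assms(2,3) herm[of x] by (intro kernel_form_insert) auto
      also have "\<dots> = kernel_form S A z - cnj s * s / A x x"
        unfolding c_def using False real by (simp add: field_simps)
      also have "\<dots> = kernel_form S ?A z"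
        unfolding cs unfolding kernel_form_def s_def sum_product sum_divide_distrib
          sum_subtractf[symmetric]
        by (intro sum.cong) (auto simp: algebra_simps)
      finally show ?thesis .
    qed
    moreover have "?A j i = cnj (?A i j)" if "i \<in> S" "j \<in> S" for i j
      using herm[of i j] herm[of i x] herm[of x j] real that by (simp add: mult.commute)
    ultimately show ?thesis
      unfolding psd_kernel_def by blast
  qed
qed

text \<open>A Cholesky decomposition by induction on \<open>S\<close>: the eliminated index
  \<open>x\<close> contributes one vector, the Schur complement on the rest provides the others.
  Indexing the vectors by \<open>S\<close> itself gives each elimination a new index.\<close>

lemma psd_kernel_gram:
  assumes "finite S" "psd_kernel S A"
  obtains u where "\<And>i j. i \<in> S \<Longrightarrow> j \<in> S \<Longrightarrow> A i j = (\<Sum>r\<in>S. cnj (u r i) * u r j)"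
proof -
  have "\<exists>u. \<forall>i\<in>S. \<forall>j\<in>S. A i j = (\<Sum>r\<in>S. cnj (u r i) * u r j)"
    using assms
  proof (induction S arbitrary: A rule: finite_induct)
    case (insert x S)
    note psd = insert.prems
    define d where "d = Re (A x x)"
    have d: "A x x = of_real d" "d \<ge> 0"
      using psd_kernel_diag[OF psd, of x] insert.hyps
      by (auto simp: d_def less_eq_complex_def complex_eq_iff)
    have herm: "A i x = cnj (A x i)" if "i \<in> insert x S" for i
      using psd that unfolding psd_kernel_def by blast
    have zero: "A x i = 0" "A i x = 0" if "d = 0" "i \<in> insert x S" for i
      using psd_kernel_zero_diag[OF psd, of x i] that d insert.hyps herm[OF that(2)] by auto
    obtain u where u: "\<And>i j. i \<in> S \<Longrightarrow> j \<in> S \<Longrightarrow>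
        A i j - A i x * A x j / A x x = (\<Sum>r\<in>S. cnj (u r i) * u r j)"
      using insert.IH[OF psd_kernel_schur_complement[OF psd insert.hyps]] by blast
    \<comment> \<open>The vector for \<open>x\<close> is row \<open>x\<close> divided by the root of
      the pivot, hence the zero vector when \<open>d = 0\<close>; the inductive vectors are extended
      by 0 at \<open>x\<close>.\<close>
    define w where "w r i = (if r = x then A x i / of_real (sqrt d)
        else if i = x then 0 else u r i)" for r i
    have "A i j = (\<Sum>r\<in>insert x S. cnj (w r i) * w r j)" if ij: "i \<in> insert x S" "j \<in> insert x S" for i j
    proof -
      have "cnj (w x i) * w x j = cnj (A x i) * A x j / of_real (sqrt d * sqrt d)"
        unfolding w_def by (simp del: real_sqrt_mult_self)
      then have pivot: "cnj (w x i) * w x j = A i x * A x j / A x x"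
        using d herm[OF ij(1)] by simp
      have "(\<Sum>r\<in>S. cnj (w r i) * w r j)
          = (if i = x \<or> j = x then 0 else \<Sum>r\<in>S. cnj (u r i) * u r j)"
        unfolding w_def using insert.hyps by (auto intro!: sum.cong sum.neutral)
      \<comment> \<open>At \<open>i = x\<close> or \<open>j = x\<close> the right-hand side is 0: by
        cancellation if the pivot is positive, and by \<open>zero\<close> otherwise.\<close>
      also have "\<dots> = A i j - A i x * A x j / A x x"
        using u[of i j] ij zero d by (cases "d = 0") auto
      finally show ?thesis
        using insert.hyps pivot by simp
    qed
    then show ?case by blast
  qed simp
  then show thesis
    using that by blast
qed

text \<open>Once \<open>A l k\<close> is expanded, the sums over \<open>l\<close> and
  \<open>k\<close> separate for each \<open>r\<close>. They contract \<open>w\<close> with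
  \<open>u r\<close> to the vector \<open>v r\<close> on \<open>T\<close>, where the form of
  \<open>B\<close> is nonnegative.\<close>

lemma kronecker_form_nonneg:
  assumes "finite S" "psd_kernel S A" "psd_kernel T B"
  shows "0 \<le> (\<Sum>l\<in>S. \<Sum>p\<in>T. \<Sum>k\<in>S. \<Sum>q\<in>T. cnj (w l p) * (A l k * B p q) * w k q)"
proof -
  obtain u where u: "\<And>i j. i \<in> S \<Longrightarrow> j \<in> S \<Longrightarrow> A i j = (\<Sum>r\<in>S. cnj (u r i) * u r j)"
    using psd_kernel_gram[OF assms(1,2)] by blast
  define v where "v r q = (\<Sum>k\<in>S. u r k * w k q)" for r q
  define g where "g r l p k q = cnj (u r l * w l p) * B p q * (u r k * w k q)" for r l p k q
  have "(\<Sum>l\<in>S. \<Sum>p\<in>T. \<Sum>k\<in>S. \<Sum>q\<in>T. cnj (w l p) * (A l k * B p q) * w k q)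
      = (\<Sum>l\<in>S. \<Sum>p\<in>T. \<Sum>k\<in>S. \<Sum>q\<in>T. \<Sum>r\<in>S. g r l p k q)"
    by (intro sum.cong refl)
      (simp add: u g_def sum_distrib_left sum_distrib_right mult_ac)
  also have "\<dots> = (\<Sum>r\<in>S. \<Sum>p\<in>T. \<Sum>q\<in>T. \<Sum>l\<in>S. \<Sum>k\<in>S. g r l p k q)"
  proof -
    \<comment> \<open>Adjacent sums are exchanged one pair at a time: \<open>r\<close> moves to the
      front, then \<open>p\<close> and \<open>q\<close> move ahead of \<open>l\<close> and
      \<open>k\<close>.\<close>
    have "(\<Sum>l\<in>S. \<Sum>p\<in>T. \<Sum>k\<in>S. \<Sum>q\<in>T. \<Sum>r\<in>S. g r l p k q)
        = (\<Sum>l\<in>S. \<Sum>p\<in>T. \<Sum>k\<in>S. \<Sum>r\<in>S. \<Sum>q\<in>T. g r l p k q)"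
      by (intro sum.cong refl sum.swap)
    also have "\<dots> = (\<Sum>l\<in>S. \<Sum>p\<in>T. \<Sum>r\<in>S. \<Sum>k\<in>S. \<Sum>q\<in>T. g r l p k q)"
      by (intro sum.cong refl sum.swap)
    also have "\<dots> = (\<Sum>l\<in>S. \<Sum>r\<in>S. \<Sum>p\<in>T. \<Sum>k\<in>S. \<Sum>q\<in>T. g r l p k q)"
      by (intro sum.cong refl sum.swap)
    also have "\<dots> = (\<Sum>r\<in>S. \<Sum>l\<in>S. \<Sum>p\<in>T. \<Sum>k\<in>S. \<Sum>q\<in>T. g r l p k q)"
      by (rule sum.swap)
    also have "\<dots> = (\<Sum>r\<in>S. \<Sum>p\<in>T. \<Sum>l\<in>S. \<Sum>k\<in>S. \<Sum>q\<in>T. g r l p k q)"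
      by (intro sum.cong refl sum.swap)
    also have "\<dots> = (\<Sum>r\<in>S. \<Sum>p\<in>T. \<Sum>l\<in>S. \<Sum>q\<in>T. \<Sum>k\<in>S. g r l p k q)"
      by (intro sum.cong refl sum.swap)
    also have "\<dots> = (\<Sum>r\<in>S. \<Sum>p\<in>T. \<Sum>q\<in>T. \<Sum>l\<in>S. \<Sum>k\<in>S. g r l p k q)"
      by (intro sum.cong refl sum.swap)
    finally show ?thesis .
  qed
  also have "\<dots> = (\<Sum>r\<in>S. kernel_form T B (v r))"
    unfolding kernel_form_def v_def g_def cnj_sum
    by (simp add: sum_distrib_left sum_distrib_right)
      (intro sum.cong refl sum.swap)
  also have "0 \<le> \<dots>"
    using assms(3) unfolding psd_kernel_def by (intro sum_nonneg) blast
  finally show ?thesis .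
qed

text \<open>Vectors of dimension \<open>N\<close> and arbitrary functions give the same values of
  the form, because a function can be truncated to \<open>vec N z\<close>.\<close>

lemma psd_mat_leading_submat_iff:
  "psd_mat (leading_submat N A) \<longleftrightarrow> psd_kernel {..<N} A"
proof -
  have adj: "mat_adjoint (leading_submat N A) = leading_submat N A \<longleftrightarrow>
      (\<forall>i\<in>{..<N}. \<forall>j\<in>{..<N}. A j i = cnj (A i j))"
    unfolding mat_adjoint_def leading_submat_def
    by (auto simp: mat_eq_iff mat_of_rows_def eq_commute[of "cnj _"])
  have form: "scalar_prod (conjugate z) (leading_submat N A *\<^sub>v z) = kernel_form {..<N} A (($) z)"
    if "z \<in> carrier_vec N" for z
    using that unfolding leading_submat_def kernel_form_def
    by (auto simp: scalar_prod_def sum_distrib_left mult.assoc atLeast0LessThan intro!: sum.cong)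
  have "(\<forall>z \<in> carrier_vec N. 0 \<le> kernel_form {..<N} A (($) z)) \<longleftrightarrow>
      (\<forall>z. 0 \<le> kernel_form {..<N} A z)"
  proof (intro iffI allI ballI)
    fix z assume "\<forall>z \<in> carrier_vec N. 0 \<le> kernel_form {..<N} A (($) z)"
    then have "0 \<le> kernel_form {..<N} A (($) (vec N z))"
      by auto
    also have "\<dots> = kernel_form {..<N} A z"
      by (rule kernel_form_cong) simp
    finally show "0 \<le> kernel_form {..<N} A z" .
  qed auto
  moreover have "dim_row (leading_submat N A) = N" "square_mat (leading_submat N A)"
    by (auto simp: leading_submat_def)
  ultimately show ?thesis
    unfolding psd_mat_def psd_kernel_def using adj form by auto
qed

lemma psd_semi_inf_iff: "psd_semi_inf A \<longleftrightarrow> (\<forall>N. psd_kernel {..<N} A)"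
  unfolding psd_semi_inf_def psd_mat_leading_submat_iff ..

section \<open>The Jury product\<close>

text \<open>The pairs \<open>(l, i - l)\<close> run through the triangle \<open>l + p < N\<close>.
  Padding with zeros to the full square makes the ranges of \<open>l\<close> and \<open>p\<close>
  independent, as a Kronecker form requires.\<close>

lemma sum_antidiagonals:
  fixes g :: "nat \<Rightarrow> nat \<Rightarrow> 'a :: comm_monoid_add"
  shows "(\<Sum>i<N. \<Sum>l=0..i. g l (i - l)) = (\<Sum>l<N. \<Sum>p<N. if l + p < N then g l p else 0)"
proof -
  have "(\<Sum>i<N. \<Sum>l=0..i. g l (i - l)) = (\<Sum>(l, p)\<in>{(l, p). l + p < N}. g l p)"
    by (simp add: sum.triangle_reindex atLeast0AtMost)
  also have "\<dots> = (\<Sum>(l, p)\<in>{..<N} \<times> {..<N}. if l + p < N then g l p else 0)"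
    by (rule sum.mono_neutral_cong_left) (auto split: if_splits)
  finally show ?thesis
    by (simp add: sum.cartesian_product)
qed

text \<open>Entries of the product with indices below \<open>N\<close> involve only entries of the
  factors with indices below \<open>N\<close>, so each leading block can be treated
  separately.\<close>

lemma psd_kernel_jury_prod:
  assumes "psd_kernel {..<N} A" "psd_kernel {..<N} B"
  shows "psd_kernel {..<N} (A \<diamondop> B)"
  unfolding psd_kernel_def
proof (intro conjI ballI allI)
  fix i j assume "i \<in> {..<N}" "j \<in> {..<N}"
  then have ij: "i < N" "j < N"
    by auto
  have herm: "A k l = cnj (A l k)" "B k l = cnj (B l k)" if "l < N" "k < N" for l k
    using assms that unfolding psd_kernel_def by blast+
  have "(A \<diamondop> B) j i = (\<Sum>l=0..i. \<Sum>k=0..j. A k l * B (j - k) (i - l))"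
    unfolding jury_prod_def by (rule sum.swap)
  also have "\<dots> = cnj ((A \<diamondop> B) i j)"
    unfolding jury_prod_def cnj_sum by (intro sum.cong refl) (use ij in \<open>auto simp flip: herm\<close>)
  finally show "(A \<diamondop> B) j i = cnj ((A \<diamondop> B) i j)" .
next
  fix z :: "nat \<Rightarrow> complex"
  define w where "w l p = (if l + p < N then z (l + p) else 0)" for l p
  \<comment> \<open>The summand is abstracted to \<open>h\<close> so that the same reindexing serves
    the row index and the column index. It has to vanish at 0 because \<open>w\<close> does so
    outside the triangle.\<close>
  have w: "(\<Sum>i<N. \<Sum>l=0..i. h (z i) l (i - l)) = (\<Sum>l<N. \<Sum>p<N. h (w l p) l p)"
    if "\<And>l p. h 0 l p = 0" for h :: "complex \<Rightarrow> nat \<Rightarrow> nat \<Rightarrow> complex"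
  proof -
    have "(\<Sum>i<N. \<Sum>l=0..i. h (z i) l (i - l)) = (\<Sum>i<N. \<Sum>l=0..i. h (z (l + (i - l))) l (i - l))"
      by (intro sum.cong) auto
    also have "\<dots> = (\<Sum>l<N. \<Sum>p<N. if l + p < N then h (z (l + p)) l p else 0)"
      by (rule sum_antidiagonals)
    also have "\<dots> = (\<Sum>l<N. \<Sum>p<N. h (w l p) l p)"
      using that by (intro sum.cong) (auto simp: w_def)
    finally show ?thesis .
  qed
  have "kernel_form {..<N} (A \<diamondop> B) z
      = (\<Sum>i<N. \<Sum>j<N. \<Sum>l=0..i. \<Sum>k=0..j. cnj (z i) * (A l k * B (i - l) (j - k)) * z j)"
    unfolding kernel_form_def jury_prod_def by (simp add: sum_distrib_left sum_distrib_right)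
  \<comment> \<open>Putting the sum over \<open>l\<close> next to the one over \<open>i\<close> lets
    \<open>w\<close> act on rows first and on columns afterwards.\<close>
  also have "\<dots> = (\<Sum>i<N. \<Sum>l=0..i. \<Sum>j<N. \<Sum>k=0..j. cnj (z i) * (A l k * B (i - l) (j - k)) * z j)"
    by (intro sum.cong refl sum.swap)
  also have "\<dots> = (\<Sum>l<N. \<Sum>p<N. \<Sum>j<N. \<Sum>k=0..j. cnj (w l p) * (A l k * B p (j - k)) * z j)"
    by (rule w[where h = "\<lambda>c l p. \<Sum>j<N. \<Sum>k=0..j. cnj c * (A l k * B p (j - k)) * z j"]) simp
  also have "\<dots> = (\<Sum>l<N. \<Sum>p<N. \<Sum>k<N. \<Sum>q<N. cnj (w l p) * (A l k * B p q) * w k q)"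
    by (intro sum.cong refl w[where h = "\<lambda>c k q. cnj (w _ _) * (A _ k * B _ q) * c"]) simp
  also have "0 \<le> \<dots>"
    by (intro kronecker_form_nonneg assms) simp
  finally show "0 \<le> kernel_form {..<N} (A \<diamondop> B) z" .
qed

lemma psd_semi_inf_jury_prod:
  "psd_semi_inf A \<Longrightarrow> psd_semi_inf B \<Longrightarrow> psd_semi_inf (A \<diamondop> B)"
  by (simp add: psd_semi_inf_iff psd_kernel_jury_prod)

lemma psd_semi_inf_foldl_jury_prod:
  assumes "psd_semi_inf A" "\<And>B. B \<in> set Bs \<Longrightarrow> psd_semi_inf B"
  shows "psd_semi_inf (foldl (\<diamondop>) A Bs)"
  using assms by (induction Bs arbitrary: A) (auto intro: psd_semi_inf_jury_prod)

section \<open>Sums of independent random variables\<close>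

text \<open>The event that the sum is \<open>(i, j)\<close> is split by the value
  \<open>(l, k)\<close> of \<open>X\<close>. Only \<open>l \<le> i\<close> and
  \<open>k \<le> j\<close> occur, and there the truncated subtraction is exact.\<close>

lemma (in prob_space) prob_matrix_add:
  assumes ind: "indep_var (count_space UNIV) X (count_space UNIV) Y"
  shows "prob_matrix M (\<lambda>\<omega>. X \<omega> + Y \<omega>) = prob_matrix M X \<diamondop> prob_matrix M Y"
proof (intro ext)
  fix i j
  have [measurable]: "X \<in> M \<rightarrow>\<^sub>M count_space UNIV" "Y \<in> M \<rightarrow>\<^sub>M count_space UNIV"
    using indep_var_rv1[OF ind] indep_var_rv2[OF ind] by auto
  define E where "E = (\<lambda>(l, k). {\<omega> \<in> space M. X \<omega> = (l, k) \<and> Y \<omega> = (i - l, j - k)})"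
  have prob_E: "prob (E (l, k)) = prob {\<omega> \<in> space M. X \<omega> = (l, k)} *
      prob {\<omega> \<in> space M. Y \<omega> = (i - l, j - k)}" for l k
  proof -
    have "E (l, k) = (\<lambda>\<omega>. (X \<omega>, Y \<omega>)) -` ({(l, k)} \<times> {(i - l, j - k)}) \<inter> space M"
      by (auto simp: E_def)
    moreover have "{\<omega> \<in> space M. X \<omega> = (l, k)} = X -` {(l, k)} \<inter> space M"
      "{\<omega> \<in> space M. Y \<omega> = (i - l, j - k)} = Y -` {(i - l, j - k)} \<inter> space M"
      by auto
    ultimately show ?thesis
      using indep_varD[OF ind, of "{(l, k)}" "{(i - l, j - k)}"] by simp
  qed
  have "{\<omega> \<in> space M. X \<omega> + Y \<omega> = (i, j)} = (\<Union>lk\<in>{0..i} \<times> {0..j}. E lk)"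
    by (auto simp: E_def prod_eq_iff)
  then have "prob {\<omega> \<in> space M. X \<omega> + Y \<omega> = (i, j)} = (\<Sum>lk\<in>{0..i} \<times> {0..j}. prob (E lk))"
    by (simp, intro finite_measure_finite_Union)
      (auto simp: E_def disjoint_family_on_def)
  also have "\<dots> = (\<Sum>(l, k)\<in>{0..i} \<times> {0..j}. prob (E (l, k)))"
    by (intro sum.cong) auto
  also have "\<dots> = (\<Sum>l=0..i. \<Sum>k=0..j. prob {\<omega> \<in> space M. X \<omega> = (l, k)} *
      prob {\<omega> \<in> space M. Y \<omega> = (i - l, j - k)})"
    by (simp only: prob_E sum.cartesian_product)
  finally show "prob_matrix M (\<lambda>\<omega>. X \<omega> + Y \<omega>) i j = (prob_matrix M X \<diamondop> prob_matrix M Y) i j"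
    by (simp add: prob_matrix_def jury_prod_def)
qed

text \<open>With one summand frozen at \<open>a\<close>, adding it is a map out of a discrete space
  and hence measurable. Countability of the type then allows \<open>a\<close> to be replaced by
  \<open>f i x\<close>.\<close>

lemma measurable_sum_count_space:
  fixes f :: "'i \<Rightarrow> 'a \<Rightarrow> 'b :: {countable, comm_monoid_add}"
  assumes "\<And>i. i \<in> I \<Longrightarrow> f i \<in> M \<rightarrow>\<^sub>M count_space UNIV"
  shows "(\<lambda>x. \<Sum>i\<in>I. f i x) \<in> M \<rightarrow>\<^sub>M count_space UNIV"
  using assms
proof (induction I rule: infinite_finite_induct)
  case (insert i I)
  have IH: "(\<lambda>x. \<Sum>i\<in>I. f i x) \<in> M \<rightarrow>\<^sub>M count_space UNIV"
    using insert by simp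
  have "(\<lambda>x. a + (\<Sum>i\<in>I. f i x)) \<in> M \<rightarrow>\<^sub>M count_space UNIV" for a
    by (rule measurable_compose[OF IH]) simp
  then have "(\<lambda>x. f i x + (\<Sum>i\<in>I. f i x)) \<in> M \<rightarrow>\<^sub>M count_space UNIV"
    using insert.prems
    by (rule measurable_compose_countable[where f = "\<lambda>a x. a + (\<Sum>i\<in>I. f i x)" and g = "f i"]) auto
  then show ?case
    using insert.hyps by simp
qed simp_all

text \<open>The tuples of variables over the disjoint sets \<open>I\<close> and \<open>{i}\<close>
  are independent, and the sum and \<open>X i\<close> are measurable functions of them: summation
  and evaluation at \<open>i\<close>.\<close>

lemma (in prob_space) indep_var_sum_count_space:
  fixes X :: "'i \<Rightarrow> 'a \<Rightarrow> 'b :: {countable, comm_monoid_add}"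
  assumes I: "i \<notin> I" and ind: "indep_vars (\<lambda>_. count_space UNIV) X (insert i I)"
  shows "indep_var (count_space UNIV) (\<lambda>\<omega>. \<Sum>k\<in>I. X k \<omega>) (count_space UNIV) (X i)"
proof -
  have "indep_var
      (count_space UNIV) ((\<lambda>f. \<Sum>k\<in>I. f k) \<circ> (\<lambda>\<omega>. restrict (\<lambda>k. X k \<omega>) I))
      (count_space UNIV) ((\<lambda>f. f i) \<circ> (\<lambda>\<omega>. restrict (\<lambda>k. X k \<omega>) {i}))"
    using I by (intro indep_var_compose[OF indep_var_restrict[OF ind]] measurable_sum_count_space
        measurable_component_singleton) auto
  also have "(\<lambda>f. \<Sum>k\<in>I. f k) \<circ> (\<lambda>\<omega>. restrict (\<lambda>k. X k \<omega>) I) = (\<lambda>\<omega>. \<Sum>k\<in>I. X k \<omega>)"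
    by (auto intro: sum.cong)
  also have "(\<lambda>f. f i) \<circ> (\<lambda>\<omega>. restrict (\<lambda>k. X k \<omega>) {i}) = X i"
    by auto
  finally show ?thesis .
qed

text \<open>The induction starts at 1, where \<open>[2..<Suc n]\<close> is empty and the fold is its
  initial value. The new variable is the right summand, matching the factor that a left fold
  appends.\<close>

lemma (in prob_space) prob_matrix_sum:
  assumes "n \<ge> 1" "indep_vars (\<lambda>_. count_space UNIV) X {1..n}"
  shows "prob_matrix M (\<lambda>\<omega>. \<Sum>k = 1..n. X k \<omega>) =
    foldl (\<diamondop>) (prob_matrix M (X 1)) (map (\<lambda>k. prob_matrix M (X k)) [2..<Suc n])"
  using assms
proof (induction n rule: nat_induct_at_least)
  case base
  then show ?case by simp
next
  case (Suc n)
  have "{1..Suc n} = insert (Suc n) {1..n}"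
    by auto
  then have ind: "indep_vars (\<lambda>_. count_space UNIV) X (insert (Suc n) {1..n})"
    using Suc.prems by simp
  have "prob_matrix M (\<lambda>\<omega>. \<Sum>k = 1..Suc n. X k \<omega>)
      = prob_matrix M (\<lambda>\<omega>. \<Sum>k = 1..n. X k \<omega>) \<diamondop> prob_matrix M (X (Suc n))"
    using prob_matrix_add[OF indep_var_sum_count_space[OF _ ind]] by simp
  also have "prob_matrix M (\<lambda>\<omega>. \<Sum>k = 1..n. X k \<omega>) =
      foldl (\<diamondop>) (prob_matrix M (X 1)) (map (\<lambda>k. prob_matrix M (X k)) [2..<Suc n])"
    using indep_vars_subset[OF ind] by (intro Suc.IH) auto
  finally show ?case
    using Suc.hyps by simp
qed

theorem corollary3p5:
  fixes M :: "'w measure" and X :: "nat \<Rightarrow> 'w \<Rightarrow> nat \<times> nat" and n :: nat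
  assumes "prob_space M"
    and "n \<ge> 1"
    and "prob_space.indep_vars M (\<lambda>_. count_space UNIV) X {1..n}"
  shows "prob_matrix M (\<lambda>\<omega>. \<Sum>k = 1..n. X k \<omega>) =
           foldl (\<diamondop>) (prob_matrix M (X 1)) (map (\<lambda>k. prob_matrix M (X k)) [2..<Suc n])
       \<and> ((\<forall>k \<in> {1..n}. psd_semi_inf (prob_matrix M (X k))) \<longrightarrow>
            psd_semi_inf (prob_matrix M (\<lambda>\<omega>. \<Sum>k = 1..n. X k \<omega>)))"
proof -
  note sum = prob_space.prob_matrix_sum[OF assms]
  show ?thesis
    \<comment> \<open>Rewriting with \<open>sum\<close> leaves closure of semidefiniteness under the
      fold; \<open>n \<ge> 1\<close> places its initial matrix among those assumed
      semidefinite.\<close>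
    unfolding sum using assms(2) by (intro conjI impI psd_semi_inf_foldl_jury_prod) auto
qed

end
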